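(* $$\sum_{k=1}^{\infty}\left[\frac{(2k)!}{2^{2k}(k!)^2}\right]^3\sum_{j=0}^{k-1}\frac{1}{2j+1}=\frac{\pi}{24}\,\frac{6\pi-\sqrt{2}\,\Gamma(1/4)\,\Gamma(3/4)}{\Gamma^4(3/4)}.$$
   Context: $\Gamma$ is the Euler gamma function; $\Gamma^4(3/4)$ means $(\Gamma(3/4))^4$. *)

theory Defs
  imports "HOL-Analysis.Analysis"
begin

end

theory Submission
  imports Defs "HOL-Real_Asymp.Real_Asymp"
begin

text \<open>
  Write \<open>(x)\<^sub>k\<close> for \<open>pochhammer x k\<close>. The ratio \<open>(2k)! / (4^k k!^2)\<close> is \<open>(1/2)\<^sub>k / k!\<close>, and the
  logarithmic derivative of \<open>(x)\<^sub>k\<close> at \<open>x = 1/2\<close> is twice the sum of \<open>1 / (2j + 1)\<close> over \<open>j < k\<close>.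
  Hence six times the series in question is the derivative at \<open>x = 1/2\<close> of
  \<open>S(x) = \<Sum>k. ((x)\<^sub>k / k!)^3\<close>. Now \<open>S(x)\<close> is the case \<open>a = b = c = x\<close> of Dixon's well-poised
  series 3F2 at 1, which has a closed form \<open>R(x)\<close> in Gamma functions (\<open>binomial_cube_sums\<close>), so
  the series is \<open>R'(1/2) / 6\<close>. The reflection formulas give \<open>R(1/2) = \<pi> / \<Gamma>(3/4)^4\<close>, and the
  logarithmic derivative of \<open>R\<close> at \<open>1/2\<close> reduces to \<open>\<psi>(3/4) - \<psi>(1/4) = \<pi>\<close> for the digamma
  function \<open>\<psi>\<close>. The value \<open>\<pi>^2 / (6 \<Gamma>(3/4)^4)\<close> is the asserted one because
  \<open>\<surd>2 \<Gamma>(1/4) \<Gamma>(3/4) = 2\<pi>\<close>.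

  Dixon's theorem is needed with two equal parameters (\<open>dixon_sums\<close>). With \<open>x\<close> fixed, let
  \<open>F(a)\<close> be the sum of \<open>(a)\<^sub>k (x)\<^sub>k^2 / (k! (1+a-x)\<^sub>k^2)\<close>. A Wilf-Zeilberger certificate yields a
  first-order recurrence between \<open>F(a)\<close> and \<open>F(a + 2)\<close> (\<open>dixon_suminf_recurrence\<close>), and
  \<open>F(a + 2n)\<close> tends to 1 because every term but the first vanishes in the limit
  (\<open>dixon_suminf_shift_LIMSEQ\<close>). So \<open>F(a)\<close> is an infinite product, evaluated by the Gamma
  asymptotics of \<open>(z)\<^sub>n\<close>.

  Termwise differentiation of \<open>S\<close> rests on \<open>pochhammer_log_derivative_le\<close>: the derivative of a term
  at \<open>x\<close> is at most a constant times the same term at a slightly larger argument.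
\<close>

section \<open>Asymptotics of the terms\<close>

lemma pos_not_nonpos_Int: "z > 0 \<Longrightarrow> z \<notin> \<int>\<^sub>\<le>\<^sub>0" for z :: real
  by (auto elim!: nonpos_Ints_cases)

lemma pochhammer_powr_LIMSEQ:
  fixes z :: real
  shows "(\<lambda>n. pochhammer z n / fact n * real n powr (1 - z)) \<longlonglongrightarrow> rGamma z"
proof -
  have "(\<lambda>n. rGamma_series z n * (real n / (real n + z))) \<longlonglongrightarrow> rGamma z * 1"
    by (intro tendsto_mult rGamma_series_LIMSEQ) real_asymp
  moreover have "\<forall>\<^sub>F n in sequentially. rGamma_series z n * (real n / (real n + z))
      = pochhammer z n / fact n * real n powr (1 - z)"
  proof -
    have "\<forall>\<^sub>F n in sequentially. real n > \<bar>z\<bar>"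
      using filterlim_real_sequentially unfolding filterlim_at_top_dense by blast
    thus ?thesis
    proof eventually_elim
      case (elim n)
      have "real n powr (1 - z) = real n / exp (z * ln (real n))"
        using elim by (simp add: powr_diff) (simp add: powr_def)
      with elim show ?case
        by (simp add: rGamma_series_def pochhammer_Suc divide_simps add_ac)
    qed
  qed
  ultimately show ?thesis
    by (simp add: tendsto_cong)
qed

text \<open>
  The \<open>k\<close>-th term of Dixon's well-poised series 3F2(\<open>a, b, c; 1+a-b, 1+a-c; 1\<close>) with both
  parameters \<open>b\<close> and \<open>c\<close> equal to \<open>x\<close>.
\<close>
definition dixon_term :: "real \<Rightarrow> real \<Rightarrow> nat \<Rightarrow> real" where
  "dixon_term a x k =
     pochhammer a k * pochhammer x k ^ 2 / (fact k * pochhammer (1 + a - x) k ^ 2)"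

lemma dixon_term_0 [simp]: "dixon_term a x 0 = 1"
  by (simp add: dixon_term_def)

lemma dixon_term_Suc:
  "dixon_term a x (Suc k) =
     dixon_term a x k * ((a + k) * (x + k) ^ 2 / ((1 + k) * (1 + a - x + k) ^ 2))"
  by (simp add: dixon_term_def pochhammer_Suc power_mult_distrib add_ac mult_ac)

lemma dixon_term_plus2:
  assumes "a > 0" "x < 1 + a"
  shows "dixon_term (a + 2) x k = dixon_term a x k *
    ((a + k) * (a + k + 1) * ((1 + a - x) * (2 + a - x)) ^ 2
      / (a * (a + 1) * ((1 + a - x + k) * (2 + a - x + k)) ^ 2))"
proof (induction k)
  case 0
  show ?case using assms by simp
next
  case (Suc k)
  define u where "u = a + real k"
  define v where "v = 1 + a - x + real k"
  have pos: "u > 0" "v > 0" "a > 0" "1 + a - x > 0"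
    using assms by (auto simp: u_def v_def)
  have eqs: "a + 2 + real k = u + 2" "1 + (a + 2) - x + real k = v + 2"
    "a + real k = u" "a + real k + 1 = u + 1" "1 + a - x + real k = v" "2 + a - x + real k = v + 1"
    "a + real (Suc k) = u + 1" "a + real (Suc k) + 1 = u + 2" "1 + a - x + real (Suc k) = v + 1" "2 + a - x + real (Suc k) = v + 2"
    by (simp_all add: u_def v_def)
  show ?case
    unfolding dixon_term_Suc Suc.IH eqs using pos
    by (simp add: divide_simps)
qed

text \<open>
  Each Pochhammer symbol grows like \<open>(z)\<^sub>k / k! \<sim> k^(z-1) / \<Gamma>(z)\<close>. The resulting exponent
  \<open>4 x - 3 - a\<close> of the terms is below \<open>-1\<close> exactly when \<open>4 x < a + 2\<close>.
\<close>
lemma dixon_term_powr_LIMSEQ: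
  assumes "1 + a - x > 0"
  shows "(\<lambda>k. dixon_term a x k * real k powr (3 + a - 4 * x))
           \<longlonglongrightarrow> rGamma a * rGamma x ^ 2 / rGamma (1 + a - x) ^ 2"
proof -
  define c where "c = (\<lambda>z n. pochhammer z n / fact n * real n powr (1 - z))"
  have c: "c z \<longlonglongrightarrow> rGamma z" for z
    unfolding c_def by (rule pochhammer_powr_LIMSEQ)
  have "1 + a - x \<notin> \<int>\<^sub>\<le>\<^sub>0"
    using assms by (rule pos_not_nonpos_Int)
  hence "(\<lambda>k. c a k * c x k ^ 2 / c (1 + a - x) k ^ 2)
          \<longlonglongrightarrow> rGamma a * rGamma x ^ 2 / rGamma (1 + a - x) ^ 2"
    by (intro tendsto_intros c) (simp add: rGamma_eq_zero_iff)
  moreover have "\<forall>\<^sub>F k in sequentially. c a k * c x k ^ 2 / c (1 + a - x) k ^ 2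
      = dixon_term a x k * real k powr (3 + a - 4 * x)"
    using eventually_gt_at_top[of 0]
  proof eventually_elim
    case (elim k)
    have "real k powr (1 - a) * (real k powr (1 - x)) ^ 2
        = real k powr (3 + a - 4 * x) * (real k powr (x - a)) ^ 2"
      by (simp add: power2_eq_square algebra_simps flip: powr_add)
    moreover have "pochhammer (1 + a - x) k > 0"
      by (rule pochhammer_pos) fact
    ultimately show ?case using elim
      by (simp add: c_def dixon_term_def divide_simps power2_eq_square mult_ac)
  qed
  ultimately show ?thesis
    by (rule Lim_transform_eventually)
qed

lemma dixon_term_bigo:
  assumes "1 + a - x > 0"
  shows "dixon_term a x \<in> O(\<lambda>k. real k powr (4 * x - 3 - a))"
proof (rule bigoI_tendsto)
  show "(\<lambda>k. dixon_term a x k / real k powr (4 * x - 3 - a))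
           \<longlonglongrightarrow> rGamma a * rGamma x ^ 2 / rGamma (1 + a - x) ^ 2"
    using dixon_term_powr_LIMSEQ[OF assms]
    by (rule Lim_transform_eventually)
       (auto intro!: always_eventually simp: divide_inverse algebra_simps simp flip: powr_minus)
next
  show "\<forall>\<^sub>F k in sequentially. real k powr (4 * x - 3 - a) \<noteq> 0"
    using eventually_gt_at_top[of 0] by eventually_elim auto
qed

lemma summable_dixon_term:
  assumes "1 + a - x > 0" "4 * x < a + 2"
  shows "summable (dixon_term a x)"
  by (rule summable_comparison_test_bigo[OF _ dixon_term_bigo])
     (use assms in \<open>auto simp: summable_real_powr_iff\<close>)

lemma dixon_term_times_index_LIMSEQ:
  assumes "1 + a - x > 0" "4 * x < a + 2"
  shows "(\<lambda>k. dixon_term a x k * real k) \<longlonglongrightarrow> 0"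
proof -
  have "(\<lambda>k. dixon_term a x k * real k powr (3 + a - 4 * x) * real k powr (4 * x - a - 2))
          \<longlonglongrightarrow> rGamma a * rGamma x ^ 2 / rGamma (1 + a - x) ^ 2 * 0"
    using assms
    by (intro tendsto_mult dixon_term_powr_LIMSEQ tendsto_neg_powr filterlim_real_sequentially) auto
  moreover have "\<forall>\<^sub>F k in sequentially.
      dixon_term a x k * real k powr (3 + a - 4 * x) * real k powr (4 * x - a - 2)
        = dixon_term a x k * real k"
    using eventually_gt_at_top[of 0]
    by eventually_elim (simp add: mult.assoc flip: powr_add)
  ultimately show ?thesis
    by (simp add: tendsto_cong)
qed

section \<open>The recurrence in the first parameter\<close>

text \<open>
  The polynomial factor of the Wilf-Zeilberger certificate, found by Gosper's algorithm. The
  combination of \<open>dixon_term (a + 2) x k\<close> and \<open>dixon_term a x k\<close> dictated by the closed form is the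
  difference \<open>G (k + 1) - G k\<close>, where up to a factor independent of \<open>k\<close>
  \<open>G k = dixon_term a x k * k * dixon_certificate a x k / (1 + a - x + k)^2\<close>.
  The monic polynomial is multiplied by \<open>a\<close> here, so that its coefficients are polynomial in \<open>a\<close>
  and \<open>x\<close>.
\<close>
definition dixon_certificate :: "real \<Rightarrow> real \<Rightarrow> real \<Rightarrow> real" where
  "dixon_certificate a x k = a * k ^ 2 + a * (3 * a - 4 * x + 3) * k
     + (2 * a ^ 3 + 3 * a ^ 2 - a - 2 - 4 * a ^ 2 * x + 2 * a * x + 8 * x
         - a * x ^ 2 - 10 * x ^ 2 + 4 * x ^ 3)"

text \<open>
  The telescoping relation after division by the factors common to all terms.
\<close>
lemma dixon_certificate_identity:
  assumes "v = 1 + a - x + k"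
  shows "(1 + a - 2 * x) * (a + 2 - 2 * x) ^ 3 * ((a + k) * (a + k + 1))
           - (a + 2 - 4 * x) * a * (v * (v + 1)) ^ 2
       = (a + k) * (x + k) ^ 2 * dixon_certificate a x (k + 1)
           - k * (v + 1) ^ 2 * dixon_certificate a x k"
  unfolding dixon_certificate_def assms by algebra

lemma dixon_suminf_recurrence:
  assumes a: "a > 0" and ax: "x < 1 + a" and x: "4 * x < a + 2"
  shows "(1 + a) * (1 + a - 2 * x) * (a + 2 - 2 * x) ^ 3 * suminf (dixon_term (a + 2) x)
       = (a + 2 - 4 * x) * ((1 + a - x) * (2 + a - x)) ^ 2 * suminf (dixon_term a x)"
proof -
  define P where "P = dixon_certificate a x"
  define A where "A = (1 + a) * (1 + a - 2 * x) * (a + 2 - 2 * x) ^ 3"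
  define B where "B = (a + 2 - 4 * x) * ((1 + a - x) * (2 + a - x)) ^ 2"
  define C where "C = ((1 + a - x) * (2 + a - x)) ^ 2 / a"
  define G where "G = (\<lambda>k. C * (dixon_term a x k * real k * (P (real k) / (1 + a - x + real k) ^ 2)))"
  have step: "A * dixon_term (a + 2) x k - B * dixon_term a x k = G (Suc k) - G k" for k
  proof -
    define t where "t = dixon_term a x k"
    define v where "v = 1 + a - x + real k"
    define q where "q = ((1 + a - x) * (2 + a - x)) ^ 2"
    define K where "K = real k"
    have pos: "v > 0" "a > 0" "K \<ge> 0" using a ax by (auto simp: v_def K_def)
    have eqs: "1 + a - x + K = v" "2 + a - x + K = v + 1"
      "1 + a - x + (K + 1) = v + 1" "real (Suc k) = K + 1" "real k = K"
      by (simp_all add: v_def K_def)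
    have id: "(1 + a - 2 * x) * (a + 2 - 2 * x) ^ 3 * ((a + K) * (a + K + 1))
           - (a + 2 - 4 * x) * a * (v * (v + 1)) ^ 2
       = (a + K) * (x + K) ^ 2 * P (K + 1) - K * (v + 1) ^ 2 * P K"
      unfolding P_def by (rule dixon_certificate_identity) (simp add: v_def K_def)
    have "A * dixon_term (a + 2) x k - B * dixon_term a x k
      = q * t / (a * (v * (v + 1)) ^ 2) * ((1 + a - 2 * x) * (a + 2 - 2 * x) ^ 3 * ((a + K) * (a + K + 1))
           - (a + 2 - 4 * x) * a * (v * (v + 1)) ^ 2)"
      unfolding dixon_term_plus2[OF a ax] A_def B_def eqs
      unfolding q_def[symmetric] t_def[symmetric] using pos
      by (simp add: divide_simps power_mult_distrib) algebra
    also have "\<dots> = q * t / (a * (v * (v + 1)) ^ 2) *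
       ((a + K) * (x + K) ^ 2 * P (K + 1) - K * (v + 1) ^ 2 * P K)"
      by (simp only: id)
    also have "\<dots> = G (Suc k) - G k"
      unfolding G_def C_def dixon_term_Suc eqs
      unfolding q_def[symmetric] t_def[symmetric] using pos
      by (simp add: divide_simps power_mult_distrib) algebra
    finally show ?thesis .
  qed
  have "(\<lambda>k. P (real k) / (1 + a - x + real k) ^ 2) \<longlonglongrightarrow> a"
    unfolding P_def dixon_certificate_def by real_asymp
  hence "G \<longlonglongrightarrow> C * (0 * a)"
    unfolding G_def using a ax x
    by (intro tendsto_mult tendsto_const dixon_term_times_index_LIMSEQ) auto
  hence "(\<lambda>k. G (Suc k) - G k) sums (0 - G 0)"
    by (intro telescope_sums) simp
  hence "(\<lambda>k. A * dixon_term (a + 2) x k - B * dixon_term a x k) sums 0"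
    by (simp add: step G_def)
  moreover have "(\<lambda>k. A * dixon_term (a + 2) x k - B * dixon_term a x k) sums
      (A * suminf (dixon_term (a + 2) x) - B * suminf (dixon_term a x))"
    using a ax x
    by (intro sums_diff sums_mult summable_sums summable_dixon_term) auto
  ultimately have "A * suminf (dixon_term (a + 2) x) - B * suminf (dixon_term a x) = 0"
    using sums_unique2 by blast
  thus ?thesis by (simp add: A_def B_def)
qed

section \<open>Dixon's theorem with two equal parameters\<close>

lemma dixon_term_LIMSEQ_shift:
  "(\<lambda>n. dixon_term (a + 2 * real n) x k) \<longlonglongrightarrow> (if k = 0 then 1 else 0)"
proof (induction k)
  case (Suc k)
  have "(\<lambda>n. (a + 2 * real n + real k) * (x + real k) ^ 2
           / ((1 + real k) * (1 + (a + 2 * real n) - x + real k) ^ 2)) \<longlonglongrightarrow> 0"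
    by real_asymp
  from tendsto_mult[OF Suc.IH this] show ?case
    by (simp add: dixon_term_Suc)
qed auto

lemma dixon_term_nonneg:
  assumes "a > 0"
  shows "dixon_term a x k \<ge> 0"
  unfolding dixon_term_def using assms
  by (intro divide_nonneg_nonneg mult_nonneg_nonneg pochhammer_nonneg) auto

lemma dixon_term_antimono:
  assumes "1 \<le> a" "a \<le> b" "0 < x" "x \<le> 1"
  shows "dixon_term b x k \<le> dixon_term a x k"
proof (induction k)
  case (Suc k)
  define d s t where "d = 1 - x" and "s = a + real k" and "t = b + real k"
  have *: "0 \<le> d" "d \<le> 1" "1 \<le> s" "s \<le> t"
    using assms by (auto simp: d_def s_def t_def)
  have "d * d \<le> t * s"
    using * by (intro mult_mono) auto
  hence "0 \<le> (t - s) * (t * s - d * d)"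
    using * by (intro mult_nonneg_nonneg) auto
  also have "\<dots> = s * (t + d) ^ 2 - t * (s + d) ^ 2"
    by (simp add: power2_eq_square algebra_simps)
  finally have "t / (t + d) ^ 2 \<le> s / (s + d) ^ 2"
    using * by (simp add: divide_simps mult_ac)
  hence "t / (t + d) ^ 2 * ((x + real k) ^ 2 / (1 + real k))
      \<le> s / (s + d) ^ 2 * ((x + real k) ^ 2 / (1 + real k))"
    by (intro mult_right_mono) auto
  hence "t * (x + real k) ^ 2 / ((1 + real k) * (t + d) ^ 2)
      \<le> s * (x + real k) ^ 2 / ((1 + real k) * (s + d) ^ 2)"
    by (simp add: mult_ac)
  moreover have "1 + a - x + real k = s + d" "1 + b - x + real k = t + d"
    by (simp_all add: d_def s_def t_def)
  moreover have "0 \<le> t * (x + real k) ^ 2 / ((1 + real k) * (t + d) ^ 2)"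
    using * by auto
  ultimately show ?case
    unfolding dixon_term_Suc s_def [symmetric] t_def [symmetric] using assms Suc.IH
    by (intro mult_mono dixon_term_nonneg) simp_all
qed auto

lemma dixon_suminf_shift_LIMSEQ:
  assumes "0 < x" "x \<le> 1"
  shows "(\<lambda>n. suminf (dixon_term (a + 2 * real n) x)) \<longlonglongrightarrow> 1"
proof -
  have "((\<lambda>n. \<Sum>k. dixon_term (a + 2 * real n) x k) \<longlongrightarrow> (\<Sum>k. if k = 0 then 1 else 0)) sequentially"
  proof (rule tannerys_theorem[THEN conjunct2, THEN conjunct2])
    \<comment> \<open>For \<open>a = 3\<close> the dominating series converges for every \<open>x \<le> 1\<close>.\<close>
    have "\<forall>\<^sub>F n in sequentially. a + 2 * real n \<ge> 3"
      by real_asymp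
    hence "\<forall>\<^sub>F n in sequentially. \<forall>k. norm (dixon_term (a + 2 * real n) x k) \<le> dixon_term 3 x k"
      by eventually_elim (use assms in \<open>auto intro!: dixon_term_antimono simp: dixon_term_nonneg\<close>)
    thus "\<forall>\<^sub>F (k, n) in sequentially \<times>\<^sub>F sequentially.
            norm (dixon_term (a + 2 * real n) x k) \<le> dixon_term 3 x k"
      unfolding eventually_prod_filter using eventually_True by fastforce
    show "summable (dixon_term 3 x)"
      using assms by (intro summable_dixon_term) auto
  qed (auto simp: dixon_term_LIMSEQ_shift)
  moreover have "(\<Sum>k. if k = 0 then 1 else 0) = (1 :: real)"
    using sums_single[of 0 "\<lambda>_. 1 :: real"] by (simp add: sums_iff)
  ultimately show ?thesis by simp
qed

lemma dixon_sums:
  assumes a: "a > 0" and x: "0 < x" "x \<le> 1" "4 * x < a + 2"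
  shows "dixon_term a x sums
    (Gamma (1 + a / 2) * Gamma (1 + a / 2 - 2 * x) * Gamma (1 + a - x) ^ 2 /
     (Gamma (1 + a) * Gamma (1 + a - 2 * x) * Gamma (1 + a / 2 - x) ^ 2))"
proof -
  define p :: "real \<Rightarrow> nat \<Rightarrow> real" where "p = pochhammer"
  define F where "F = (\<lambda>a. suminf (dixon_term a x))"
  \<comment> \<open>The product of the first \<open>n\<close> ratios in the recurrence. The factor \<open>2 + a + 2 m\<close> has been
    inserted above and below, so that the linear factors combine into Pochhammer symbols.\<close>
  define Q where "Q = (\<lambda>n. p (1 + a) (2 * n) * p (1 + a - 2 * x) (2 * n) * p (1 + a / 2 - x) n ^ 2
      / (p (1 + a - x) (2 * n) ^ 2 * p (1 + a / 2) n * p (1 + a / 2 - 2 * x) n))"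
  have p_pos: "p z n > 0" if "z > 0" for z n
    unfolding p_def using that by (rule pochhammer_pos)
  have p_Suc: "p z (Suc n) = p z n * (z + n)" for z n
    by (simp add: p_def pochhammer_Suc)

  have FQ: "F a = Q n * F (a + 2 * real n)" for n
  proof (induction n)
    case (Suc n)
    define b where "b = a + 2 * real n"
    have b: "b > 0" "4 * x < b + 2" "x < 1 + b"
      using a x by (auto simp: b_def)
    have "Q (Suc n) = Q n * ((1 + b) * (1 + b - 2 * x) * (b + 2 - 2 * x) ^ 3 /
        ((b + 2 - 4 * x) * ((1 + b - x) * (2 + b - x)) ^ 2))"
    proof -
      have e: "1 + a + real (2 * n) = 1 + b" "1 + a + real (Suc (2 * n)) = 2 + b"
        "1 + a - 2 * x + real (2 * n) = 1 + b - 2 * x" "1 + a - 2 * x + real (Suc (2 * n)) = b + 2 - 2 * x"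
        "1 + a - x + real (2 * n) = 1 + b - x" "1 + a - x + real (Suc (2 * n)) = 2 + b - x"
        "1 + a / 2 - x + real n = (b + 2 - 2 * x) / 2" "1 + a / 2 + real n = (2 + b) / 2"
        "1 + a / 2 - 2 * x + real n = (b + 2 - 4 * x) / 2" "2 * Suc n = Suc (Suc (2 * n))"
        by (simp_all add: b_def field_simps)
      have ratio: "p1 * s * u * (p2 * r * w) * (p3 * (w / 2)) ^ 2
            / ((p4 * v * v') ^ 2 * (p5 * (u / 2)) * (p6 * (y / 2)))
          = p1 * p2 * p3 ^ 2 / (p4 ^ 2 * p5 * p6) * (s * r * w ^ 3 / (y * (v * v') ^ 2))"
        (is "?N / ?D = ?X / ?Y * (?X' / ?Y')")
        if "u \<noteq> 0" for p1 p2 p3 p4 p5 p6 s r u v v' w y :: real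
      proof -
        have N: "?N = ?X * ?X' * (u / 4)"
          by (simp add: power2_eq_square power3_eq_cube)
        have D: "?D = ?Y * ?Y' * (u / 4)"
          by (simp add: power2_eq_square)
        show ?thesis
          unfolding N D times_divide_times_eq
          using that by (intro mult_divide_mult_cancel_right) simp
      qed
      show ?thesis
        unfolding Q_def e(10) p_Suc e(1-9) by (rule ratio) (use b in auto)
    qed
    also have "\<dots> * F (b + 2) = Q n * F b"
      using dixon_suminf_recurrence[of b x] b x
      by (simp add: F_def divide_simps mult_ac)
    finally show ?case using Suc.IH by (simp add: b_def algebra_simps)
  qed (simp add: Q_def p_def)

  \<comment> \<open>Once every Pochhammer symbol in \<open>Q n\<close> is normalised to converge, the powers of \<open>n\<close> cancel.\<close>
  define c where "c = (\<lambda>z n. p z n / fact n * real n powr (1 - z))"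
  have c: "c z \<longlonglongrightarrow> rGamma z" for z
    unfolding c_def p_def by (rule pochhammer_powr_LIMSEQ)
  have c2: "(\<lambda>n. c z (2 * n)) \<longlonglongrightarrow> rGamma z" for z
    by (rule filterlim_compose[OF c]) (auto intro!: mult_nat_left_at_top)
  define L where "L = rGamma (1 + a) * rGamma (1 + a - 2 * x) * rGamma (1 + a / 2 - x) ^ 2
      / (rGamma (1 + a - x) ^ 2 * rGamma (1 + a / 2) * rGamma (1 + a / 2 - 2 * x))"
  have "(\<lambda>n. c (1 + a) (2 * n) * c (1 + a - 2 * x) (2 * n) * c (1 + a / 2 - x) n ^ 2
      / (c (1 + a - x) (2 * n) ^ 2 * c (1 + a / 2) n * c (1 + a / 2 - 2 * x) n)) \<longlonglongrightarrow> L"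
    unfolding L_def using a x
    by (intro tendsto_intros c c2) (auto simp: rGamma_eq_zero_iff pos_not_nonpos_Int)
  moreover have "\<forall>\<^sub>F n in sequentially.
      c (1 + a) (2 * n) * c (1 + a - 2 * x) (2 * n) * c (1 + a / 2 - x) n ^ 2
      / (c (1 + a - x) (2 * n) ^ 2 * c (1 + a / 2) n * c (1 + a / 2 - 2 * x) n) = Q n"
    using eventually_gt_at_top[of 0]
  proof eventually_elim
    case (elim n)
    define A :: "real \<Rightarrow> real" where "A = (\<lambda>z. real (2 * n) powr (1 - z) / fact (2 * n))"
    define B :: "real \<Rightarrow> real" where "B = (\<lambda>z. real n powr (1 - z) / fact n)"
    have nz: "A z \<noteq> 0" "B z \<noteq> 0" for z
      using elim by (auto simp: A_def B_def)
    have c_A: "c z (2 * n) = p z (2 * n) * A z" and c_B: "c z n = p z n * B z" for z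
      by (simp_all add: c_def A_def B_def)
    have A: "A (1 + a) * A (1 + a - 2 * x) = A (1 + a - x) ^ 2"
      by (simp add: A_def power2_eq_square algebra_simps flip: powr_add)
    have B: "B (1 + a / 2 - x) ^ 2 = B (1 + a / 2) * B (1 + a / 2 - 2 * x)"
      by (simp add: B_def power2_eq_square algebra_simps flip: powr_add)
    have ratio: "p1 * A1 * (p2 * A2) * (p3 * B3) ^ 2 / ((p4 * A4) ^ 2 * (p5 * B5) * (p6 * B6))
        = p1 * p2 * p3 ^ 2 / (p4 ^ 2 * p5 * p6)"
      (is "?N / ?D = ?X / ?Y")
      if eq: "A1 * A2 = A4 ^ 2" "B3 ^ 2 = B5 * B6" and nz: "A4 \<noteq> 0" "B5 \<noteq> 0" "B6 \<noteq> 0"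
      for p1 p2 p3 p4 p5 p6 A1 A2 A4 B3 B5 B6 :: real
    proof -
      have "?N = ?X * (A1 * A2 * B3 ^ 2)"
        by (simp add: power2_eq_square)
      hence N: "?N = ?X * (A4 ^ 2 * (B5 * B6))"
        unfolding eq .
      have D: "?D = ?Y * (A4 ^ 2 * (B5 * B6))"
        by (simp add: power2_eq_square)
      show ?thesis
        unfolding N D using nz by (intro mult_divide_mult_cancel_right) simp
    qed
    show ?case
      unfolding c_A c_B Q_def by (rule ratio[OF A B nz(1) nz(2) nz(2)])
  qed
  ultimately have "Q \<longlonglongrightarrow> L"
    by (rule Lim_transform_eventually)
  hence "(\<lambda>n. Q n * F (a + 2 * real n)) \<longlonglongrightarrow> L * 1"
    unfolding F_def using x by (intro tendsto_mult dixon_suminf_shift_LIMSEQ) auto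
  hence "(\<lambda>n. F a) \<longlonglongrightarrow> L"
    by (simp flip: FQ)
  hence "F a = L"
    by (simp add: LIMSEQ_const_iff)
  moreover have "dixon_term a x sums F a"
    unfolding F_def using a x by (intro summable_sums summable_dixon_term) auto
  moreover have "L = Gamma (1 + a / 2) * Gamma (1 + a / 2 - 2 * x) * Gamma (1 + a - x) ^ 2 /
     (Gamma (1 + a) * Gamma (1 + a - 2 * x) * Gamma (1 + a / 2 - x) ^ 2)"
    (is "L = ?Y / ?X")
  proof -
    have "L = inverse ?X / inverse ?Y"
      unfolding L_def rGamma_inverse_Gamma power_inverse inverse_mult_distrib
      by (simp only: mult_ac)
    also have "inverse u / inverse v = v / u" for u v :: real
      by (simp add: divide_inverse)
    finally show ?thesis .
  qed
  ultimately show ?thesis by simp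
qed

section \<open>Reflection formulas\<close>

lemma Gamma_reflection_real: "Gamma x * Gamma (1 - x) = pi / sin (pi * x)" for x :: real
proof -
  have "complex_of_real (Gamma x * Gamma (1 - x)) = complex_of_real (pi / sin (pi * x))"
    using Gamma_reflection_complex[of "of_real x"]
    by (simp flip: Gamma_complex_of_real sin_of_real)
  thus ?thesis by (simp only: of_real_eq_iff)
qed

lemma Digamma_reflection_real:
  fixes x :: real
  assumes "0 < x" "x < 1"
  shows "Digamma (1 - x) - Digamma x = pi * cot (pi * x)"
proof -
  have s: "sin (pi * x) > 0"
    using assms by (intro sin_gt_zero) auto
  define G where "G = Gamma x * Gamma (1 - x)"
  have "((\<lambda>x. Gamma x * Gamma (1 - x)) has_real_derivative G * (Digamma x - Digamma (1 - x))) (at x)"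
    unfolding G_def using assms
    by (auto intro!: derivative_eq_intros pos_not_nonpos_Int simp: algebra_simps)
  moreover have "((\<lambda>x. pi / sin (pi * x)) has_real_derivative - (pi * cot (pi * x)) * G) (at x)"
    unfolding G_def Gamma_reflection_real using s
    by (auto intro!: derivative_eq_intros simp: cot_def power2_eq_square)
  ultimately have "G * (Digamma x - Digamma (1 - x)) = - (pi * cot (pi * x)) * G"
    unfolding Gamma_reflection_real by (rule DERIV_unique)
  moreover have "G \<noteq> 0"
    using s by (simp add: G_def Gamma_reflection_real)
  moreover have "G * (Digamma (1 - x) - Digamma x - pi * cot (pi * x))
      = - (G * (Digamma x - Digamma (1 - x))) - pi * cot (pi * x) * G"
    by (simp add: algebra_simps)
  ultimately show ?thesis by simp
qed

section \<open>Termwise differentiation of the diagonal series\<close>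

lemma pochhammer_has_derivative:
  fixes x :: real
  assumes "x > 0"
  shows "((\<lambda>x. pochhammer x n) has_real_derivative
           pochhammer x n * (\<Sum>j<n. 1 / (x + real j))) (at x within A)"
proof (induction n)
  case (Suc n)
  have "x + real n > 0" using assms by simp
  thus ?case unfolding pochhammer_Suc
    by (auto intro!: derivative_eq_intros Suc.IH simp: field_simps)
qed (auto intro!: derivative_eq_intros)

text \<open>
  Bernoulli's inequality for the product \<open>(x + h)\<^sub>n / (x)\<^sub>n = \<Prod>j<n. 1 + h / (x + j)\<close>. It bounds the
  derivative of \<open>(x)\<^sub>n\<close> by \<open>(x + h)\<^sub>n / h\<close>.
\<close>
lemma pochhammer_log_derivative_le:
  fixes x h :: real
  assumes "x > 0" "h \<ge> 0"
  shows "pochhammer x n * (1 + h * (\<Sum>j<n. 1 / (x + real j))) \<le> pochhammer (x + h) n"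
proof (induction n)
  case (Suc n)
  define D where "D = (\<Sum>j<n. 1 / (x + real j))"
  have D: "D \<ge> 0" and pos: "pochhammer x n > 0" "x + real n > 0"
    unfolding D_def using assms by (auto intro!: sum_nonneg pochhammer_pos)
  have "pochhammer x (Suc n) * (1 + h * (\<Sum>j<Suc n. 1 / (x + real j)))
      = pochhammer x n * ((x + n) * (1 + h * D) + h)"
    using pos by (simp add: pochhammer_Suc D_def[symmetric] field_simps)
  also have "\<dots> \<le> pochhammer x n * ((1 + h * D) * (x + h + n))"
    using pos D assms by (intro mult_left_mono) (auto simp: algebra_simps)
  also have "\<dots> \<le> pochhammer (x + h) n * (x + h + n)"
    using Suc.IH assms unfolding D_def[symmetric]
    by (subst mult.assoc[symmetric], intro mult_right_mono) auto
  finally show ?case by (simp add: pochhammer_Suc)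
qed auto

text \<open>
  The cube of \<open>(x)\<^sub>k / k!\<close>, which is up to sign the binomial coefficient of \<open>-x\<close> over \<open>k\<close>.
\<close>
definition binomial_cube :: "real \<Rightarrow> nat \<Rightarrow> real" where
  "binomial_cube x k = (pochhammer x k / fact k) ^ 3"

lemma dixon_term_diagonal: "dixon_term x x k = binomial_cube x k"
  by (simp add: dixon_term_def binomial_cube_def pochhammer_fact[symmetric] power2_eq_square power3_eq_cube)

lemma binomial_cube_has_derivative:
  assumes "x > 0"
  shows "((\<lambda>x. binomial_cube x k) has_real_derivative
           3 * binomial_cube x k * (\<Sum>j<k. 1 / (x + real j))) (at x within A)"
  unfolding binomial_cube_def using assms
  by (auto intro!: derivative_eq_intros pochhammer_has_derivative
           simp: power2_eq_square power3_eq_cube)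

lemma binomial_cube_derivative_bound:
  assumes "0 < x" "x < y"
  shows "\<bar>3 * binomial_cube x k * (\<Sum>j<k. 1 / (x + real j))\<bar> \<le> 3 / (y - x) * binomial_cube y k"
proof -
  define D where "D = (\<Sum>j<k. 1 / (x + real j))"
  define p q where "p = pochhammer x k" and "q = pochhammer y k"
  have D: "D \<ge> 0" and p: "p > 0"
    unfolding D_def p_def using assms by (auto intro!: sum_nonneg pochhammer_pos)
  have le: "p * (1 + (y - x) * D) \<le> q"
    using pochhammer_log_derivative_le[of x "y - x" k] assms by (simp add: p_def q_def D_def)
  have *: "p * ((y - x) * D) \<le> q" "p \<le> q"
  proof -
    have "0 \<le> p * ((y - x) * D)"
      using p D assms by (intro mult_nonneg_nonneg) auto
    with le p show "p * ((y - x) * D) \<le> q" "p \<le> q"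
      unfolding distrib_left by linarith+
  qed
  have "p ^ 2 * (p * ((y - x) * D)) \<le> q ^ 2 * q"
    using * p D assms by (intro mult_mono power_mono) auto
  hence "(y - x) * (p ^ 3 * D) \<le> q ^ 3"
    by (simp add: power2_eq_square power3_eq_cube mult_ac)
  hence "p ^ 3 * D \<le> q ^ 3 / (y - x)"
    using assms by (simp add: field_simps)
  hence "p ^ 3 * D * (3 / fact k ^ 3) \<le> q ^ 3 / (y - x) * (3 / fact k ^ 3)"
    by (rule mult_right_mono) simp
  moreover have "0 \<le> 3 * binomial_cube x k * D"
    using D p by (auto simp: binomial_cube_def p_def)
  ultimately show ?thesis
    unfolding D_def[symmetric] by (simp add: binomial_cube_def p_def q_def power_divide mult_ac)
qed

lemma binomial_cube_sums:
  assumes "0 < x" "3 * x < 2"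
  shows "binomial_cube x sums (Gamma (1 + x / 2) * Gamma (1 - 3 * x / 2) /
     (Gamma (1 + x) * Gamma (1 - x) * Gamma (1 - x / 2) ^ 2))"
proof -
  have "dixon_term x x = binomial_cube x"
    by (rule ext) (rule dixon_term_diagonal)
  moreover have "1 + x / 2 - 2 * x = 1 - 3 * x / 2" "1 + x - 2 * x = 1 - x" "1 + x / 2 - x = 1 - x / 2"
    by (simp_all add: field_simps)
  ultimately show ?thesis
    using dixon_sums[of x x] assms by simp
qed

text \<open>
  Both sides of \<open>binomial_cube_sums\<close> are differentiated with respect to \<open>x\<close>.
\<close>
lemma binomial_cube_derivative_sums:
  assumes x: "0 < x" "3 * x < 2"
  shows "(\<lambda>k. 3 * binomial_cube x k * (\<Sum>j<k. 1 / (x + real j))) sums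
     (Gamma (1 + x / 2) * Gamma (1 - 3 * x / 2) /
     (Gamma (1 + x) * Gamma (1 - x) * Gamma (1 - x / 2) ^ 2) *
      (Digamma (1 + x / 2) / 2 - 3 / 2 * Digamma (1 - 3 * x / 2)
       - Digamma (1 + x) + Digamma (1 - x) + Digamma (1 - x / 2)))"
proof -
  \<comment> \<open>On \<open>{0<..<y}\<close> the differentiated series is dominated by a multiple of the series at \<open>z\<close>.\<close>
  obtain z where z: "x < z" "z < 2 / 3"
    using dense[of x "2 / 3"] x by auto
  obtain y where y: "x < y" "y < z"
    using dense[of x z] z by auto
  define S where "S = {0<..<y}"
  define f' where "f' = (\<lambda>k x. 3 * binomial_cube x k * (\<Sum>j<k. 1 / (x + real j)))"
  define R where "R = (\<lambda>x. Gamma (1 + x / 2) * Gamma (1 - 3 * x / 2) /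
     (Gamma (1 + x) * Gamma (1 - x) * Gamma (1 - x / 2) ^ 2) :: real)"
  have bound: "\<bar>f' k w\<bar> \<le> 3 / (z - y) * binomial_cube z k" if "w \<in> S" for k w
  proof -
    have "\<bar>f' k w\<bar> \<le> 3 / (z - w) * binomial_cube z k"
      unfolding f'_def using that y z by (intro binomial_cube_derivative_bound) (auto simp: S_def)
    also have "\<dots> \<le> 3 / (z - y) * binomial_cube z k"
      using that x y z unfolding S_def binomial_cube_def
      by (intro mult_right_mono divide_left_mono zero_le_power divide_nonneg_nonneg pochhammer_nonneg) auto
    finally show ?thesis .
  qed
  have "summable (binomial_cube z)"
    using binomial_cube_sums[of z] x y z by (auto simp: sums_iff)
  hence sM: "summable (\<lambda>k. 3 / (z - y) * binomial_cube z k)"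
    by (rule summable_mult)
  have unif: "uniformly_convergent_on S (\<lambda>n w. \<Sum>i<n. f' i w)"
    by (rule Weierstrass_m_test'[OF _ sM]) (use bound in auto)
  have sums: "binomial_cube w sums R w" if "w \<in> S" for w
    unfolding R_def using that y z by (intro binomial_cube_sums) (auto simp: S_def)
  have "((\<lambda>w. \<Sum>k. binomial_cube w k) has_real_derivative (\<Sum>k. f' k x)) (at x)"
  proof (rule has_field_derivative_series'(2)[where S = S and x0 = x])
    show "((\<lambda>w. binomial_cube w k) has_real_derivative f' k w) (at w within S)"
      if "w \<in> S" for k w
      unfolding f'_def using that by (intro binomial_cube_has_derivative) (auto simp: S_def)
    show "summable (binomial_cube x)"
      using sums[of x] x y by (auto simp: S_def sums_iff)
  qed (use x y unif in \<open>auto simp: S_def\<close>)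
  moreover have "eventually (\<lambda>w. w \<in> S) (nhds x)"
    using x y by (intro eventually_nhds_in_open) (auto simp: S_def)
  hence "eventually (\<lambda>w. (\<Sum>k. binomial_cube w k) = R w) (nhds x)"
    by eventually_elim (use sums in \<open>auto simp: sums_iff\<close>)
  ultimately have "(R has_real_derivative (\<Sum>k. f' k x)) (at x)"
    by (subst (asm) DERIV_cong_ev[OF refl _ refl]) auto
  moreover have "(R has_real_derivative R x * (Digamma (1 + x / 2) / 2 - 3 / 2 * Digamma (1 - 3 * x / 2)
       - Digamma (1 + x) + Digamma (1 - x) + Digamma (1 - x / 2))) (at x)"
  proof -
    define N D where "N = (\<lambda>x :: real. Gamma (1 + x / 2) * Gamma (1 - 3 * x / 2))"
      and "D = (\<lambda>x :: real. Gamma (1 + x) * Gamma (1 - x) * Gamma (1 - x / 2) ^ 2)"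
    have N: "(N has_real_derivative
        N x * (Digamma (1 + x / 2) / 2 - 3 / 2 * Digamma (1 - 3 * x / 2))) (at x)"
      unfolding N_def using x
      by (auto intro!: derivative_eq_intros pos_not_nonpos_Int simp: algebra_simps)
    have D: "(D has_real_derivative
        D x * (Digamma (1 + x) - Digamma (1 - x) - Digamma (1 - x / 2))) (at x)"
      unfolding D_def using x
      by (auto intro!: derivative_eq_intros pos_not_nonpos_Int simp: algebra_simps power2_eq_square)
    have nz: "D x \<noteq> 0"
      using x by (simp add: D_def Gamma_eq_zero_iff pos_not_nonpos_Int)
    have "R = (\<lambda>x. N x / D x)"
      by (simp add: R_def N_def D_def fun_eq_iff)
    moreover have "(N x * n * D x - N x * (D x * d)) / (D x * D x) = N x / D x * (n - d)" for n d
      using nz by (simp add: field_simps)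
    ultimately have "(R has_real_derivative R x *
        ((Digamma (1 + x / 2) / 2 - 3 / 2 * Digamma (1 - 3 * x / 2))
          - (Digamma (1 + x) - Digamma (1 - x) - Digamma (1 - x / 2)))) (at x)"
      using DERIV_divide[OF N D nz] by simp
    thus ?thesis by (simp add: algebra_simps)
  qed
  ultimately have "(\<Sum>k. f' k x) = R x * (Digamma (1 + x / 2) / 2 - 3 / 2 * Digamma (1 - 3 * x / 2)
       - Digamma (1 + x) + Digamma (1 - x) + Digamma (1 - x / 2))"
    by (rule DERIV_unique)
  moreover have "summable (\<lambda>k. f' k x)"
    by (rule summable_comparison_test[OF _ sM]) (use bound[of x] x y in \<open>auto simp: S_def\<close>)
  ultimately show ?thesis
    by (simp add: sums_iff f'_def R_def)
qed

section \<open>The value at one half\<close>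

theorem mainTheorem3:
  shows "(\<lambda>n::nat. let k = n + 1 in
            (fact (2 * k) / (2 ^ (2 * k) * (fact k)\<^sup>2)) ^ 3 * (\<Sum>j = 0..k - 1. 1 / (2 * real j + 1)))
         sums (pi / 24 * ((6 * pi - sqrt 2 * Gamma (1/4 :: real) * Gamma (3/4 :: real)) / Gamma (3/4 :: real) ^ 4))"
proof -
  define g where "g = Gamma (3 / 4 :: real)"
  have g: "g > 0" by (simp add: g_def)
  have "pi * (1 / 4) = pi / 4" by simp
  hence sin: "sin (pi * (1 / 4)) = sqrt 2 / 2" and cot: "cot (pi * (1 / 4)) = 1"
    by (simp_all only: sin_45 cos_45 cot_def) simp
  have "Gamma (1 / 4) * g = 2 * pi / sqrt 2"
    using Gamma_reflection_real[of "1 / 4"] unfolding sin by (simp add: g_def)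
  also have "\<dots> = sqrt 2 * pi"
    by (simp add: field_simps)
  finally have G14: "Gamma (1 / 4) * g = sqrt 2 * pi" .
  have G14': "Gamma (1 / 4) = sqrt 2 * pi / g"
    using G14 g by (simp add: field_simps)
  have Gammas: "Gamma (5 / 4 :: real) = Gamma (1 / 4) / 4" "Gamma (3 / 2 :: real) = sqrt pi / 2"
    using Gamma_plus1[of "1 / 4 :: real"] Gamma_plus1[of "1 / 2 :: real"]
    by (auto simp: pos_not_nonpos_Int Gamma_one_half_real)
  have Digammas: "Digamma (5 / 4 :: real) = Digamma (1 / 4) + 4"
    "Digamma (3 / 2 :: real) = Digamma (1 / 2) + 2"
    "Digamma (3 / 4 :: real) = Digamma (1 / 4) + pi"
    using Digamma_plus1[of "1 / 4 :: real"] Digamma_plus1[of "1 / 2 :: real"]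
      Digamma_reflection_real[of "1 / 4"] cot by auto

  have "(\<lambda>k. 3 * binomial_cube (1/2) k * (\<Sum>j<k. 1 / (1/2 + real j))) sums
     (Gamma (5/4) * Gamma (1/4) / (Gamma (3/2) * Gamma (1/2) * g ^ 2) *
      (Digamma (5/4) / 2 - 3 / 2 * Digamma (1/4) - Digamma (3/2) + Digamma (1/2) + Digamma (3/4)))"
    using binomial_cube_derivative_sums[of "1/2"] by (simp add: g_def)
  also have "Digamma (5/4) / 2 - 3 / 2 * Digamma (1/4) - Digamma (3/2) + Digamma (1/2) + Digamma (3/4) = pi"
    by (simp add: Digammas add_divide_distrib)
  also have "Gamma (5/4) * Gamma (1/4) / (Gamma (3/2) * Gamma (1/2) * g ^ 2) = pi / g ^ 4"
    using g by (simp add: Gammas Gamma_one_half_real G14' field_simps power2_eq_square power4_eq_xxxx)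
  finally have sums: "(\<lambda>k. 3 * binomial_cube (1/2) k * (\<Sum>j<k. 1 / (1/2 + real j))) sums (pi / g ^ 4 * pi)" .
  define T where "T = (\<lambda>k. 3 * binomial_cube (1/2) k * (\<Sum>j<k. 1 / (1/2 + real j)))"
  have "T sums (pi / g ^ 4 * pi)" "T 0 = 0"
    using sums by (simp_all add: T_def)
  hence "(\<lambda>n. T (Suc n)) sums (pi / g ^ 4 * pi)"
    by (simp add: sums_Suc_iff)
  hence "(\<lambda>n. 1 / 6 * T (Suc n)) sums (1 / 6 * (pi / g ^ 4 * pi))"
    by (rule sums_mult)
  also have "(\<lambda>n. 1 / 6 * T (Suc n))
     = (\<lambda>n::nat. let k = n + 1 in
            (fact (2 * k) / (2 ^ (2 * k) * (fact k)\<^sup>2)) ^ 3 * (\<Sum>j = 0..k - 1. 1 / (2 * real j + 1)))"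
  proof
    fix n :: nat
    define k where "k = n + 1"
    have "(\<Sum>j<k. 1 / (1/2 + real j)) = 2 * (\<Sum>j<k. 1 / (2 * real j + 1))"
      unfolding sum_distrib_left by (intro sum.cong) (auto simp: field_simps)
    moreover have "{..<k} = {0..k - 1}"
      by (auto simp: k_def)
    moreover have "pochhammer (1/2) k / fact k = (fact (2 * k) / (2 ^ (2 * k) * (fact k)\<^sup>2) :: real)"
      unfolding fact_double by (simp add: power2_eq_square)
    ultimately have "1 / 6 * T k = (fact (2 * k) / (2 ^ (2 * k) * (fact k)\<^sup>2)) ^ 3
        * (\<Sum>j = 0..k - 1. 1 / (2 * real j + 1))"
      unfolding T_def binomial_cube_def by simp
    thus "1 / 6 * T (Suc n) = (let k = n + 1 in
            (fact (2 * k) / (2 ^ (2 * k) * (fact k)\<^sup>2)) ^ 3 * (\<Sum>j = 0..k - 1. 1 / (2 * real j + 1)))"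
      unfolding Let_def k_def Suc_eq_plus1 .
  qed
  also have "1 / 6 * (pi / g ^ 4 * pi) = pi / 24 * ((6 * pi - sqrt 2 * Gamma (1/4) * Gamma (3/4)) / Gamma (3/4) ^ 4)"
  proof -
    have "sqrt 2 * Gamma (1/4) * Gamma (3/4) = 2 * pi"
      using G14 by (simp add: g_def mult.assoc)
    thus ?thesis by (simp add: g_def)
  qed
  finally show ?thesis .
qed

end
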